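(* Let $G$ be a finite abelian group of order $v$ and suppose there exists a $(v,m,k,\lambda)$-SEDF in $G$ with $m\geq 3$. Let $p$ be an odd prime with $p^a\,\|\,v$ and let $q$ be a prime divisor of $\lambda$. Then at least one of the following holds: (1) $k(m-2)\equiv 0\pmod p$; (2) $p^a\mid mk$, and $u\equiv 0\pmod 2$ if $q$ is self-conjugate modulo $p$ and $q^u\,\|\,\lambda$.
   Context: Let $G$ be a finite abelian group of order $v$ with identity $e$. A $(v,m,k,\lambda)$-SEDF in $G$ is a collection $\{D_1,\dots,D_m\}$ of pairwise disjoint $k$-subsets of $G$ such that for each $j$ the multiset $\{xy^{-1}: x\in D_\ell,\ y\in D_j,\ \ell\neq j\}$ contains every non-identity element of $G$ exactly $\lambda$ times and does not contain $e$. $p^a\| v$ means $p^a\mid v$, $p^{a+1}\nmid v$. Self-conjugacy: for a prime $q$ and positive integer $w$, write $w=q^s u'$ with $\gcd(u',q)=1$; $q$ is self-conjugate modulo $w$ if there is an integer $r$ with $q^r\equiv -1\pmod{u'}$.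
   Formalization: The formal statement requires a ≥ 1, i.e. that p divides v; with a = 0 the claim fails, e.g. for the known (243,11,22,20)-SEDF with p = 7 and q = 5. *)

theory Defs
  imports
    "HOL-Algebra.Coset"
    "HOL-Library.Multiset"
    "HOL-Library.Disjoint_Sets"
    "HOL-Computational_Algebra.Primes"
    "HOL-Number_Theory.Cong"
begin

text \<open>The index \<open>l\<close> is kept in the triples so that every external pair contributes with its own
  multiplicity.  The multiset is the intended one when the sets \<open>D i\<close> are finite
  (\<^const>\<open>mset_set\<close> is empty on infinite sets).\<close>

definition external_differences ::
  "('a, 'b) monoid_scheme \<Rightarrow> nat \<Rightarrow> (nat \<Rightarrow> 'a set) \<Rightarrow> nat \<Rightarrow> 'a multiset" where
  "external_differences G m D j =
     image_mset (\<lambda>(l, x, y). x \<otimes>\<^bsub>G\<^esub> inv\<^bsub>G\<^esub> y)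
       (mset_set {(l, x, y). l \<in> {1..m} \<and> l \<noteq> j \<and> x \<in> D l \<and> y \<in> D j})"

text \<open>Only the values of \<open>D\<close> on \<open>{1..m}\<close> matter.  The predicate is meant for a finite abelian
  group \<open>G\<close>.\<close>

definition is_SEDF ::
  "('a, 'b) monoid_scheme \<Rightarrow> nat \<Rightarrow> nat \<Rightarrow> nat \<Rightarrow> nat \<Rightarrow> (nat \<Rightarrow> 'a set) \<Rightarrow> bool" where
  "is_SEDF G v m k lam D \<longleftrightarrow>
     order G = v \<and>
     (\<forall>i\<in>{1..m}. D i \<subseteq> carrier G \<and> card (D i) = k) \<and>
     disjoint_family_on D {1..m} \<and>
     (\<forall>j\<in>{1..m}.
        (\<forall>g\<in>carrier G - {\<one>\<^bsub>G\<^esub>}. count (external_differences G m D j) g = lam) \<and>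
        \<one>\<^bsub>G\<^esub> \<notin># external_differences G m D j)"

definition exactly_divides :: "nat \<Rightarrow> nat \<Rightarrow> nat \<Rightarrow> bool" where
  "exactly_divides p a n \<longleftrightarrow> p ^ a dvd n \<and> \<not> p ^ (a + 1) dvd n"

text \<open>Natural exponents \<open>r\<close> suffice: \<open>q\<close> is a unit of finite order modulo \<open>u\<close>, so every
  integer power of \<open>q\<close> modulo \<open>u\<close> is also a natural power.\<close>

definition self_conjugate :: "nat \<Rightarrow> nat \<Rightarrow> bool" where
  "self_conjugate q w \<longleftrightarrow>
     (\<exists>s u. w = q ^ s * u \<and> coprime u q \<and> (\<exists>r::nat. [int q ^ r = - 1] (mod int u)))"

end

theory Submission
  imports "Jordan_Normal_Form.Char_Poly" "HOL-Algebra.Sylow" "HOL-Algebra.Multiplicative_Group" Defs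
begin

text \<open>Write \<open>S\<^sub>j = \<chi>(D\<^sub>j)\<close> and \<open>s = S\<^sub>1 + \<dots> + S\<^sub>m\<close> for a nontrivial character \<open>\<chi>\<close>. The defining property
  gives \<open>(s - S\<^sub>j) S\<^sub>j\<^sup>* = -\<lambda>\<close> for all \<open>j\<close>. Let \<open>\<chi>\<close> have \<open>p\<close>-power order. If \<open>s \<noteq> 0\<close>, the ratios
  \<open>S\<^sub>j / s\<close> take exactly two values, both real, and this yields a relation \<open>a S\<^sub>i + b S\<^sub>j = 0\<close> with
  \<open>a, b \<ge> 0\<close> and \<open>a + b = m - 2\<close>; sending the roots of unity to 1 modulo \<open>p\<close> turns it into
  \<open>k (m - 2) \<equiv> 0\<close>. Otherwise \<open>s = 0\<close> for all such \<open>\<chi>\<close>, so that the union of the \<open>D\<^sub>j\<close> is uniformly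
  distributed over the cosets of the \<open>p\<close>-complement of \<open>G\<close>, whence \<open>p\<^sup>a\<close> divides \<open>m k\<close>; and a
  character of order \<open>p\<close> gives \<open>S\<^sub>1 S\<^sub>1\<^sup>* = \<lambda>\<close>, where a self-conjugate \<open>q \<noteq> p\<close> can be divided out of \<open>S\<^sub>1\<close>
  as long as it divides the norm, and each division removes \<open>q\<^sup>2\<close> from \<open>\<lambda>\<close>. The case \<open>q = p\<close> cannot
  occur, since \<open>S\<^sub>1 S\<^sub>1\<^sup>* \<equiv> k\<^sup>2\<close> modulo \<open>p\<close>.\<close>

hide_const (open) Polynomial.order up_ring.monom up_ring.coeff

section \<open>Integer polynomials at roots of unity\<close>

abbreviation eval_int_poly :: "int poly \<Rightarrow> complex \<Rightarrow> complex" where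
  "eval_int_poly f z \<equiv> poly (map_poly of_int f) z"

lemma eval_int_poly_simps:
  "eval_int_poly (f + g) z = eval_int_poly f z + eval_int_poly g z"
  "eval_int_poly (f - g) z = eval_int_poly f z - eval_int_poly g z"
  "eval_int_poly (f * g) z = eval_int_poly f z * eval_int_poly g z"
  "eval_int_poly (f ^ n) z = eval_int_poly f z ^ n"
  "eval_int_poly (pCons c f) z = of_int c + z * eval_int_poly f z"
  "eval_int_poly (monom c n) z = of_int c * z ^ n"
  "eval_int_poly (of_nat n) z = of_nat n"
  "eval_int_poly (pcompose f g) z = eval_int_poly f (eval_int_poly g z)"
  by (simp_all add: of_int_poly_hom.hom_add of_int_poly_hom.hom_minus of_int_poly_hom.hom_mult
      of_int_poly_hom.hom_power of_int_hom.map_poly_pCons_hom map_poly_monom poly_monom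
      of_int_hom.map_poly_pcompose poly_pcompose of_nat_poly)

section \<open>Frobenius congruences for integer polynomials\<close>

lemma prime_dvd_power_add:
  fixes x y :: "'a::comm_ring_1"
  assumes "prime q"
  shows "of_nat q dvd (x + y) ^ q - (x ^ q + y ^ q)"
proof -
  let ?t = "\<lambda>i. of_nat (q choose i) * x ^ i * y ^ (q - i)"
  have q: "q \<noteq> 0" using assms by auto
  have "(x + y) ^ q = (\<Sum>i\<le>q. ?t i)" by (rule binomial_ring)
  also have "{..q} = insert 0 (insert q {1..<q})" using q by auto
  also have "(\<Sum>i\<in>\<dots>. ?t i) = x ^ q + y ^ q + (\<Sum>i\<in>{1..<q}. ?t i)"
    using q by (subst sum.insert; simp)
  finally have eq: "(x + y) ^ q - (x ^ q + y ^ q) = (\<Sum>i\<in>{1..<q}. ?t i)" by simp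
  have "of_nat q dvd (\<Sum>i\<in>{1..<q}. ?t i)"
  proof (rule dvd_sum)
    fix i assume "i \<in> {1..<q}"
    hence "q dvd (q choose i)" using assms by (intro dvd_choose_prime) auto
    hence "(of_nat q :: 'a) dvd of_nat (q choose i)" by (metis dvd_def of_nat_mult)
    thus "of_nat q dvd ?t i" by (simp add: dvd_mult2)
  qed
  thus ?thesis unfolding eq .
qed

lemma prime_dvd_int_power_diff:
  fixes c :: int
  assumes "prime q"
  shows "int q dvd c ^ q - c"
proof -
  have nat: "int q dvd int n ^ q - int n" for n
  proof (induction n)
    case 0
    then show ?case using assms by (simp add: power_0_left prime_gt_0_nat)
  next
    case (Suc n)
    have "int q dvd (int n + 1) ^ q - (int n ^ q + 1 ^ q)"
      using prime_dvd_power_add[OF assms, of "int n" 1] by simp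
    from dvd_add[OF this Suc.IH] show ?case by (simp add: algebra_simps)
  qed
  have qi: "prime (int q)" using assms by simp
  have cong: "[c ^ q = (c mod int q) ^ q] (mod int q)"
    by (intro cong_pow) (simp add: cong_def)
  have "c mod int q \<ge> 0" using assms by (simp add: prime_gt_0_nat)
  hence "[(c mod int q) ^ q = c mod int q] (mod int q)"
    using nat[of "nat (c mod int q)"] by (simp add: cong_iff_dvd_diff)
  hence "[c ^ q = c] (mod int q)" using cong by (metis cong_def mod_mod_trivial)
  thus ?thesis by (simp add: cong_iff_dvd_diff)
qed

lemma dvd_power_diff:
  fixes d :: "'a::comm_ring_1"
  assumes "d dvd x - y"
  shows "d dvd x ^ n - y ^ n"
  unfolding power_diff_sumr2 by (rule dvd_mult2[OF assms])

lemma of_nat_poly_dvd_const: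
  assumes "int q dvd c"
  shows "(of_nat q :: int poly) dvd [:c:]"
proof -
  obtain e where "c = int q * e" using assms by blast
  hence "[:c:] = of_nat q * [:e:]" by (simp add: of_nat_poly)
  thus ?thesis by (simp only: dvd_triv_left)
qed

text \<open>Induction on the coefficients: the binomial congruence splits the power of c + X f,
  Fermat's little theorem handles c, and X^q factors out of the rest.\<close>

lemma frobenius_dvd_pcompose_diff:
  fixes f :: "int poly"
  assumes "prime q"
  shows "of_nat q dvd f ^ q - pcompose f (monom 1 q)"
proof (induction f)
  case 0
  then show ?case using assms by (simp add: power_0_left prime_gt_0_nat)
next
  case (pCons c f)
  have 1: "of_nat q dvd ([:c:] + [:0, 1:] * f) ^ q - ([:c:] ^ q + ([:0, 1:] * f) ^ q)"
    by (rule prime_dvd_power_add[OF assms])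
  have 2: "(of_nat q :: int poly) dvd [:c:] ^ q - [:c:]"
    using of_nat_poly_dvd_const[OF prime_dvd_int_power_diff[OF assms, of c]]
    by (simp add: poly_const_pow)
  have "[:0, 1::int:] ^ q = monom 1 q" by (simp add: monom_altdef)
  hence 3: "of_nat q dvd ([:0, 1:] * f) ^ q - monom 1 q * pcompose f (monom 1 q)"
    using dvd_mult[OF pCons.IH, of "monom 1 q"] by (simp only: power_mult_distrib right_diff_distrib)
  have "pCons c f ^ q - pcompose (pCons c f) (monom 1 q)
      = (([:c:] + [:0, 1:] * f) ^ q - ([:c:] ^ q + ([:0, 1:] * f) ^ q)) + ([:c:] ^ q - [:c:])
        + (([:0, 1:] * f) ^ q - monom 1 q * pcompose f (monom 1 q))"
    by (simp add: pcompose_pCons)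
  with dvd_add[OF dvd_add[OF 1 2] 3] show ?case by (simp only:)
qed

lemma frobenius_iterate_dvd_pcompose_diff:
  fixes f :: "int poly"
  assumes "prime q"
  shows "of_nat q dvd f ^ (q ^ t) - pcompose f (monom 1 (q ^ t))"
proof (induction t)
  case 0
  have "monom (1::int) 1 = [:0, 1:]" by (simp add: monom_altdef)
  then show ?case by (simp add: pcompose_idR)
next
  case (Suc t)
  let ?g = "pcompose f (monom 1 (q ^ t))"
  have 1: "of_nat q dvd (f ^ (q ^ t)) ^ q - ?g ^ q" by (rule dvd_power_diff[OF Suc.IH])
  have 2: "of_nat q dvd ?g ^ q - pcompose ?g (monom 1 q)"
    by (rule frobenius_dvd_pcompose_diff[OF assms])
  have "pcompose (monom (1::int) (q ^ t)) (monom 1 q) = monom 1 (q ^ Suc t)"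
    by (simp add: monom_altdef pcompose_hom.hom_power pcompose_pCons power_mult)
  hence "pcompose ?g (monom 1 q) = pcompose f (monom 1 (q ^ Suc t))"
    by (simp add: pcompose_assoc[symmetric])
  with dvd_add[OF 1 2] show ?case
    by (simp add: power_mult[symmetric] mult.commute)
qed

text \<open>The error term is again a value at \<open>z\<close>, so this is a congruence modulo q
  inside the ring Z[z], where the later divisibility arguments take place.\<close>

lemma eval_int_poly_frobenius:
  assumes "prime q"
  obtains g where
    "eval_int_poly f z ^ (q ^ t) = eval_int_poly f (z ^ (q ^ t)) + of_nat q * eval_int_poly g z"
proof -
  obtain g where g: "f ^ (q ^ t) - pcompose f (monom 1 (q ^ t)) = of_nat q * g"
    using frobenius_iterate_dvd_pcompose_diff[OF assms] by (meson dvdE)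
  have "f ^ (q ^ t) = pcompose f (monom 1 (q ^ t)) + of_nat q * g" using g by (simp add: algebra_simps)
  hence "eval_int_poly (f ^ (q ^ t)) z = eval_int_poly (pcompose f (monom 1 (q ^ t)) + of_nat q * g) z"
    by simp
  hence "eval_int_poly f z ^ (q ^ t) = eval_int_poly f (z ^ (q ^ t)) + of_nat q * eval_int_poly g z"
    by (simp add: eval_int_poly_simps poly_monom)
  thus ?thesis by (rule that)
qed

section \<open>Integrality of values at roots of unity\<close>

lemma eval_int_poly_reduce_exponents:
  assumes "z ^ Suc M = 1"
  shows "\<exists>c :: nat \<Rightarrow> int. eval_int_poly f z = (\<Sum>j<Suc M. of_int (c j) * z ^ j)"
proof (induction f)
  case 0
  show ?case by (intro exI[of _ "\<lambda>_. 0"]) simp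
next
  case (pCons d f)
  then obtain c where c: "eval_int_poly f z = (\<Sum>j<Suc M. of_int (c j) * z ^ j)" by blast
  \<comment> \<open>Multiplication by \<open>z\<close> shifts the coefficients cyclically: z^(M+1) =
    1 carries the top one, \<open>c M\<close>, back to the constant term.\<close>
  define b where "b j = (case j of 0 \<Rightarrow> d + c M | Suc i \<Rightarrow> c i)" for j
  have "eval_int_poly (pCons d f) z = of_int d + z * (\<Sum>j<Suc M. of_int (c j) * z ^ j)"
    by (simp add: c eval_int_poly_simps)
  also have "\<dots> = of_int d + (\<Sum>j<M. of_int (c j) * z ^ Suc j) + of_int (c M) * z ^ Suc M"
    by (simp add: sum_distrib_left algebra_simps)
  also have "\<dots> = (\<Sum>j<Suc M. of_int (b j) * z ^ j)"
    unfolding assms sum.lessThan_Suc_shift by (simp add: b_def)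
  finally show ?case by blast
qed

text \<open>Multiplication by \<open>f(z)\<close> acts on the spanning vector \<open>(1, z, \<dots>)\<close> by an integer matrix,
  whose characteristic polynomial is then monic and integral and has \<open>f(z)\<close> as a root.\<close>

lemma algebraic_int_eval_root_of_unity:
  assumes "z ^ N = 1" "N > 0"
  shows "algebraic_int (eval_int_poly f z)"
proof -
  obtain M where N: "N = Suc M" using assms(2) gr0_implies_Suc by blast
  define x where "x = eval_int_poly f z"
  have "\<exists>c :: nat \<Rightarrow> int. x * z ^ i = (\<Sum>j<N. of_int (c j) * z ^ j)" for i
    using eval_int_poly_reduce_exponents[of z M "f * monom 1 i"] assms(1)
    by (simp add: x_def N eval_int_poly_simps poly_monom)
  then obtain c :: "nat \<Rightarrow> nat \<Rightarrow> int"
    where c: "\<And>i. x * z ^ i = (\<Sum>j<N. of_int (c i j) * z ^ j)" by metis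
  define A where "A = mat N N (\<lambda>(i, j). c i j)"
  define v where "v = vec N (\<lambda>i. z ^ i)"
  let ?A = "map_mat complex_of_int A"
  have A: "A \<in> carrier_mat N N" by (simp add: A_def)
  have "v $ 0 = 1" using assms(2) by (simp add: v_def)
  hence v0: "v \<noteq> 0\<^sub>v N" using assms(2) by auto
  have "?A *\<^sub>v v = x \<cdot>\<^sub>v v"
  proof (rule eq_vecI)
    fix i assume "i < dim_vec (x \<cdot>\<^sub>v v)"
    hence i: "i < N" by (simp add: v_def)
    show "(?A *\<^sub>v v) $ i = (x \<cdot>\<^sub>v v) $ i"
      using i by (simp add: A_def v_def scalar_prod_def c lessThan_atLeast0)
  qed (simp add: A_def v_def)
  hence "eigenvalue ?A x"
    unfolding eigenvalue_def eigenvector_def using v0 by (intro exI[of _ v]) (simp add: A_def v_def)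
  hence "poly (char_poly ?A) x = 0"
    using eigenvalue_root_char_poly[of ?A N] A by simp
  hence "eval_int_poly (char_poly A) x = 0" by (simp add: of_int_hom.char_poly_hom[OF A])
  moreover have "lead_coeff (char_poly A) = 1" using degree_monic_char_poly[OF A] by simp
  ultimately show ?thesis unfolding algebraic_int_altdef_ipoly x_def by blast
qed

text \<open>The cofactor is rational and an algebraic integer, hence an integer. So divisibility in
  Z[z] descends to the integers.\<close>

lemma int_eq_mult_eval_root_of_unity_dvd:
  assumes "z ^ N = 1" "N > 0" "q > 0" "of_int n = of_nat q * eval_int_poly g z"
  shows "int q dvd n"
proof -
  let ?x = "eval_int_poly g z"
  have x: "?x = of_int n / of_int (int q)" using assms(3,4) by (simp add: field_simps)
  hence "?x \<in> \<rat>" by simp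
  hence "?x \<in> \<int>"
    using rational_algebraic_int_is_int algebraic_int_eval_root_of_unity[OF assms(1,2)] by blast
  then obtain y where y: "?x = of_int y" by (auto elim: Ints_cases)
  have "(of_int n :: complex) = of_int (int q * y)" using assms(4) y by simp
  hence "n = int q * y" by (simp only: of_int_eq_iff)
  thus ?thesis by simp
qed

text \<open>Reduction modulo the prime above \<open>p\<close>: roots of unity of \<open>p\<close>-power order become 1.\<close>

lemma vanishing_prime_power_root_imp_dvd:
  assumes "prime p" "z ^ (p ^ b) = 1" "eval_int_poly f z = 0"
  shows "int p dvd poly f 1"
proof -
  \<comment> \<open>Since f(z) = 0 and z^(p^b) = 1, this identity becomes 0 = f(1) + p g(z).\<close>
  obtain g where
    g: "eval_int_poly f z ^ (p ^ b) = eval_int_poly f (z ^ (p ^ b)) + of_nat p * eval_int_poly g z"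
    using eval_int_poly_frobenius[OF assms(1)] .
  have p: "p > 0" using assms(1) by (simp add: prime_gt_0_nat)
  have "eval_int_poly f 1 = of_int (poly f 1)" using of_int_hom.poly_map_poly[of f 1] by simp
  hence "of_int (- poly f 1) = of_nat p * eval_int_poly g z"
    using g assms(2,3) p by (simp add: power_0_left add_eq_0_iff)
  from int_eq_mult_eval_root_of_unity_dvd[OF assms(2) _ p this] p show ?thesis by simp
qed

section \<open>Complex conjugation and norms at self-conjugate primes\<close>

lemma cnj_root_of_unity_power:
  assumes "z ^ N = 1" "N > 0" "[int n = - 1] (mod int N)"
  shows "cnj z = z ^ n"
proof -
  \<comment> \<open>As N divides n + 1, both \<open>z ^ n\<close> and \<open>cnj z\<close> are the
    inverse of \<open>z\<close>.\<close>
  have "int N dvd int (Suc n)" using assms(3) by (simp add: cong_iff_dvd_diff add.commute)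
  hence "N dvd Suc n" by (simp only: int_dvd_int_iff)
  then obtain e where "Suc n = N * e" by blast
  hence 1: "z ^ Suc n = 1" using assms(1) by (simp only: power_mult power_one)
  have "norm z ^ N = 1 ^ N" using assms(1) by (metis norm_one norm_power power_one)
  hence "norm z = 1" by (rule power_eq_imp_eq_base) (use assms(2) in auto)
  hence "z * cnj z = 1" by (simp add: complex_norm_square[symmetric])
  moreover from this have "z \<noteq> 0" by auto
  ultimately show ?thesis using 1 by (metis mult_left_cancel power_Suc)
qed

lemma eval_int_poly_cnj: "cnj (eval_int_poly f z) = eval_int_poly f (cnj z)"
  by (induction f) (simp_all add: eval_int_poly_simps)

text \<open>When \<open>-1\<close> is a power of \<open>q\<close> modulo \<open>p\<close>, complex conjugation is a power of Frobenius modulo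
  \<open>q\<close>. So a multiple \<open>\<alpha> \<alpha>\<^sup>*\<close> of \<open>q\<close> makes a power of \<open>\<alpha>\<close> vanish modulo \<open>q\<close>, and then \<open>\<alpha>\<close> itself,
  as some further power of Frobenius fixes it.\<close>

lemma self_conjugate_norm_descent:
  assumes "prime q" "z ^ p = 1" "p > 2" "[int q ^ r = - 1] (mod int p)"
    and "eval_int_poly f z * cnj (eval_int_poly f z) = of_nat n" "q dvd n"
  obtains g where "eval_int_poly f z = of_nat q * eval_int_poly g z"
proof -
  let ?e = "\<lambda>f. eval_int_poly f z"
  have c: "cnj z = z ^ (q ^ r)" using cnj_root_of_unity_power[of z p "q ^ r"] assms by simp
  obtain g where g: "?e f ^ (q ^ r) = eval_int_poly f (z ^ (q ^ r)) + of_nat q * ?e g"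
    using eval_int_poly_frobenius[OF assms(1)] .
  obtain h where h: "?e f ^ (q ^ (2 * r)) = eval_int_poly f (z ^ (q ^ (2 * r))) + of_nat q * ?e h"
    using eval_int_poly_frobenius[OF assms(1)] .
  \<comment> \<open>Squaring gives q^(2r) = 1 modulo p, so this Frobenius power fixes
    \<open>z\<close> and therefore fixes f(z) modulo q.\<close>
  have "[(int q ^ r) ^ 2 = (- 1) ^ 2] (mod int p)" by (rule cong_pow[OF assms(4)])
  hence "[int (q ^ (2 * r)) = int 1] (mod int p)" by (simp add: power_even_eq)
  hence "[q ^ (2 * r) = 1] (mod p)" by (simp only: cong_int_iff)
  hence "q ^ (2 * r) mod p = 1" using assms(3) by (simp add: cong_def)
  then obtain e where "q ^ (2 * r) = p * e + 1" by (metis mult_div_mod_eq)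
  hence "z ^ (q ^ (2 * r)) = z" using assms(2) by (simp add: power_add power_mult)
  hence h': "?e f = ?e f ^ (q ^ (2 * r)) - of_nat q * ?e h" using h by simp
  obtain n' where n': "n = q * n'" using assms(6) by blast
  have g': "cnj (?e f) = ?e f ^ (q ^ r) - of_nat q * ?e g" using g c by (simp add: eval_int_poly_cnj)
  \<comment> \<open>Modulo q the power f(z)^(q^r) is the conjugate of f(z), so one more factor f(z)
    turns it into the norm n, a multiple of q.\<close>
  have "?e f ^ (q ^ r + 1) = ?e f * (cnj (?e f) + of_nat q * ?e g)" using g' by simp
  also have "\<dots> = of_nat q * ?e ([:int n':] + f * g)"
    using assms(5) n' by (simp add: algebra_simps eval_int_poly_simps)
  finally have small: "?e f ^ (q ^ r + 1) = of_nat q * ?e ([:int n':] + f * g)" .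
  \<comment> \<open>Positivity of r gives q^r >= 2 and hence q^r + 1 <= q^(2r), so the power already
    known to vanish modulo q divides f(z)^(q^(2r)).\<close>
  have "r \<noteq> 0"
  proof
    assume "r = 0"
    hence "int p dvd 2" using assms(4) by (simp add: cong_iff_dvd_diff)
    thus False using assms(3) zdvd_imp_le[of "int p" 2] by simp
  qed
  hence "q ^ 1 \<le> q ^ r" using assms(1) by (intro power_increasing) (auto simp: prime_gt_0_nat Suc_leI)
  hence 2: "2 \<le> q ^ r" using prime_ge_2_nat[OF assms(1)] by simp
  have "q ^ r + 1 \<le> 2 * q ^ r" using 2 by linarith
  also have "\<dots> \<le> q ^ r * q ^ r" using 2 by (intro mult_le_mono1)
  finally have "q ^ r + 1 \<le> q ^ r * q ^ r" .
  then obtain d where d: "q ^ (2 * r) = (q ^ r + 1) + d"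
    by (metis le_Suc_ex mult_2 power_add)
  have "?e f = ?e f ^ (q ^ r + 1) * ?e f ^ d - of_nat q * ?e h"
    using h' by (simp only: d power_add[of _ "q ^ r + 1" d])
  also have "\<dots> = of_nat q * ?e (([:int n':] + f * g) * f ^ d - h)"
    by (simp only: small eval_int_poly_simps(2-4)) (simp add: algebra_simps)
  finally have "?e f = \<dots>" .
  thus ?thesis by (rule that)
qed

text \<open>Strong induction on \<open>u\<close>: if q divides n, descent writes f(z) = q g(z), and
  the norm of g(z) is n / q^2. The exponent drops by two, and \<open>u = 1\<close> is impossible
  because q^2 divides n.\<close>

lemma self_conjugate_norm_even_exponent:
  assumes "prime q" "z ^ p = 1" "p > 2" "[int q ^ r = - 1] (mod int p)"
    and "eval_int_poly f z * cnj (eval_int_poly f z) = of_nat n" "exactly_divides q u n"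
  shows "even u"
  using assms(5,6)
proof (induction u arbitrary: f n rule: less_induct)
  case (less u)
  show ?case
  proof (cases "u = 0")
    case False
    have q: "q > 0" using assms(1) by (simp add: prime_gt_0_nat)
    have "q dvd n" using less.prems(2) False unfolding exactly_divides_def by (metis dvd_power dvd_trans neq0_conv)
    then obtain g where g: "eval_int_poly f z = of_nat q * eval_int_poly g z"
      using self_conjugate_norm_descent[OF assms(1-4) less.prems(1)] by blast
    let ?b = "eval_int_poly g z * cnj (eval_int_poly g z)"
    have nb: "of_nat n = (of_nat q)\<^sup>2 * ?b" using less.prems(1) g by (simp add: power2_eq_square mult_ac)
    \<comment> \<open>Conjugation is z -> z^(q^r), so \<open>h\<close> exhibits the norm of g(z) as
      a value in Z[z]; only then can divisibility by q^2 descend to n.\<close>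
    define h where "h = g * pcompose g (monom 1 (q ^ r))"
    have "cnj z = z ^ (q ^ r)" using cnj_root_of_unity_power[of z p "q ^ r"] assms by simp
    hence "?b = eval_int_poly h z"
      by (simp add: h_def eval_int_poly_cnj eval_int_poly_simps poly_monom)
    hence "of_int (int n) = of_nat (q\<^sup>2) * eval_int_poly h z" using nb by simp
    from int_eq_mult_eval_root_of_unity_dvd[OF assms(2) _ _ this] q assms(3)
    have "q\<^sup>2 dvd n" by (simp only: int_dvd_int_iff) simp
    then obtain n' where n': "n = q\<^sup>2 * n'" by blast
    have b: "?b = of_nat n'" using nb n' q by simp
    have "u \<noteq> 1" using less.prems(2) n' by (auto simp: exactly_divides_def power2_eq_square)
    hence w: "u = (u - 2) + 2" using False by simp
    define w where "w = u - 2"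
    note w = w[folded w_def]
    have "exactly_divides q w n'" using less.prems(2) q
      by (simp add: exactly_divides_def n' w power_add power2_eq_square mult_ac)
    from less.IH[OF _ b this] w show ?thesis by simp
  qed simp
qed

section \<open>Characters of finite abelian groups\<close>

text \<open>Multiplicativity is asked on \<open>H\<close> only, so that characters of subgroups can
  be extended step by step. The value at the identity rules out the zero map.\<close>

definition character_on :: "('a, 'b) monoid_scheme \<Rightarrow> 'a set \<Rightarrow> ('a \<Rightarrow> complex) \<Rightarrow> bool" where
  "character_on G H \<chi> \<longleftrightarrow>
     \<chi> \<one>\<^bsub>G\<^esub> = 1 \<and> (\<forall>x\<in>H. \<forall>y\<in>H. \<chi> (x \<otimes>\<^bsub>G\<^esub> y) = \<chi> x * \<chi> y)"

lemma character_on_one: "character_on G H \<chi> \<Longrightarrow> \<chi> \<one>\<^bsub>G\<^esub> = 1"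
  by (simp add: character_on_def)

lemma character_on_mult:
  "character_on G H \<chi> \<Longrightarrow> x \<in> H \<Longrightarrow> y \<in> H \<Longrightarrow> \<chi> (x \<otimes>\<^bsub>G\<^esub> y) = \<chi> x * \<chi> y"
  by (simp add: character_on_def)

context group
begin

lemma subgroup_nat_pow_closed:
  assumes "subgroup H G" "x \<in> H"
  shows "x [^] (n::nat) \<in> H"
  using assms by (induction n) (auto simp: subgroup.one_closed subgroup.m_closed)

lemma character_on_pow:
  assumes "character_on G H \<chi>" "subgroup H G" "x \<in> H"
  shows "\<chi> (x [^] (n::nat)) = \<chi> x ^ n"
  using assms subgroup_nat_pow_closed[OF assms(2,3)]
  by (induction n) (simp_all add: character_on_one character_on_mult)

lemma character_on_inv:
  assumes "character_on G H \<chi>" "subgroup H G" "x \<in> H"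
  shows "\<chi> x * \<chi> (inv x) = 1"
  using assms character_on_mult[OF assms(1,3), of "inv x"]
  by (simp add: character_on_one subgroup.m_inv_closed subgroup.mem_carrier)

lemma character_root_of_unity:
  assumes "character_on G (carrier G) \<chi>" "x \<in> carrier G"
  shows "\<chi> x ^ order G = 1"
  using character_on_pow[OF assms(1) subgroup_self assms(2), of "order G"] assms
  by (simp add: pow_order_eq_1 character_on_one)

lemma character_cnj:
  assumes "character_on G (carrier G) \<chi>" "finite (carrier G)" "x \<in> carrier G"
  shows "cnj (\<chi> x) = \<chi> (inv x)"
proof -
  have "norm (\<chi> x) ^ order G = 1 ^ order G"
    using character_root_of_unity[OF assms(1,3)] by (metis norm_one norm_power power_one)
  hence "norm (\<chi> x) = 1"
    by (rule power_eq_imp_eq_base) (use assms(2) in \<open>auto simp: order_gt_0_iff_finite\<close>)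
  hence "\<chi> x * cnj (\<chi> x) = 1" by (simp add: complex_norm_square[symmetric])
  moreover have "\<chi> x * \<chi> (inv x) = 1" by (rule character_on_inv[OF assms(1) subgroup_self assms(3)])
  ultimately show ?thesis by (metis mult_left_cancel mult_zero_left zero_neq_one)
qed

text \<open>Translation by \<open>g\<close> permutes the group and multiplies the sum by
  \<open>\<chi> g\<close>.\<close>

lemma sum_nontrivial_character:
  assumes "character_on G (carrier G) \<chi>" "g \<in> carrier G" "\<chi> g \<noteq> 1"
  shows "(\<Sum>x\<in>carrier G. \<chi> x) = 0"
proof -
  have "bij_betw (\<lambda>x. g \<otimes> x) (carrier G) (carrier G)"
    by (rule bij_betwI[where g = "\<lambda>x. inv g \<otimes> x"]) (use assms(2) in \<open>auto simp: m_assoc[symmetric]\<close>)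
  hence "(\<Sum>x\<in>carrier G. \<chi> x) = (\<Sum>x\<in>carrier G. \<chi> (g \<otimes> x))"
    by (rule sum.reindex_bij_betw[symmetric])
  also have "\<dots> = \<chi> g * (\<Sum>x\<in>carrier G. \<chi> x)"
    using assms by (simp add: sum_distrib_left character_on_mult)
  finally show ?thesis using assms(3) by (metis mult_cancel_right1)
qed

text \<open>The number \<open>n\<close> is the order of \<open>g\<close> in the quotient by
  \<open>H\<close>; division with remainder gives the divisibility.\<close>

lemma least_power_in_subgroup:
  assumes "finite (carrier G)" "subgroup H G" "g \<in> carrier G"
  obtains n :: nat where "n > 0" "g [^] n \<in> H" "\<And>i::nat. g [^] i \<in> H \<Longrightarrow> n dvd i"
proof -
  define n where "n = (LEAST n::nat. n > 0 \<and> g [^] n \<in> H)"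
  have "order G > 0 \<and> g [^] order G \<in> H"
    using assms by (simp add: order_gt_0_iff_finite pow_order_eq_1 subgroup.one_closed)
  hence n: "n > 0 \<and> g [^] n \<in> H" unfolding n_def by (rule LeastI)
  have "n dvd i" if i: "g [^] i \<in> H" for i :: nat
  proof (rule ccontr)
    assume "\<not> n dvd i"
    hence pos: "i mod n > 0" by (simp add: dvd_eq_mod_eq_0)
    have "g [^] i = (g [^] n) [^] (i div n) \<otimes> g [^] (i mod n)"
      using assms(3) by (simp add: nat_pow_pow nat_pow_mult)
    moreover have "(g [^] n) [^] (i div n) \<in> H" using n assms(2) by (simp add: subgroup_nat_pow_closed)
    ultimately have "g [^] (i mod n) = inv ((g [^] n) [^] (i div n)) \<otimes> g [^] i"
      using assms(3) by (simp add: m_assoc[symmetric])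
    hence "g [^] (i mod n) \<in> H"
      using i assms(2) \<open>(g [^] n) [^] (i div n) \<in> H\<close>
      by (simp add: subgroup.m_closed subgroup.m_inv_closed)
    hence "n \<le> i mod n" unfolding n_def by (intro Least_le) (use pos in \<open>simp add: n_def\<close>)
    thus False using n mod_less_divisor[of n i] by linarith
  qed
  thus ?thesis using n that by blast
qed

lemma cauchy_element:
  assumes "prime p" "finite (carrier G)" "p dvd order G"
  obtains x where "x \<in> carrier G" "x \<noteq> \<one>" "x [^] p = \<one>"
proof -
  \<comment> \<open>Sylow's theorem with exponent 1 yields a subgroup of order p.\<close>
  obtain m where "order G = p ^ 1 * m" using assms(3) by auto
  from sylow_thm[OF assms(1) is_group this assms(2)]
  obtain P where P: "subgroup P G" "card P = p" by auto
  have "P \<noteq> {\<one>}" using P(2) assms(1) by auto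
  then obtain x where x: "x \<in> P" "x \<noteq> \<one>" using P(1) subgroup.one_closed by blast
  have "group (G\<lparr>carrier := P\<rparr>)" using P(1) by (simp add: subgroup_imp_group)
  from group.pow_order_eq_1[OF this, of x] have "x [^] p = \<one>"
    using x P(2) by (simp add: order_def nat_pow_consistent[symmetric])
  thus ?thesis using that x P(1) subgroup.mem_carrier by metis
qed

end

context comm_group
begin

text \<open>Elements of the subgroup generated by \<open>H\<close> and \<open>g\<close> have the
  form h g^i, and the extension sends them to \<chi>(h) c^i. Two representations of one element have
  exponents differing by a multiple of \<open>n\<close>, so the condition on \<open>c ^ n\<close>
  makes this well defined.\<close>

lemma extend_character_by_element:
  assumes "finite (carrier G)" "subgroup H G" "character_on G H \<chi>" "g \<in> carrier G"
    and n: "g [^] (n::nat) \<in> H" "\<And>i::nat. g [^] i \<in> H \<Longrightarrow> n dvd i" "c ^ n = \<chi> (g [^] n)"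
  obtains K \<psi> where "subgroup K G" "H \<subseteq> K" "g \<in> K" "character_on G K \<psi>"
    "\<And>h. h \<in> H \<Longrightarrow> \<psi> h = \<chi> h" "\<psi> g = c"
proof -
  define K where "K = H <#> generate G {g}"
  have sub: "subgroup K G"
    unfolding K_def using assms(2,4) by (intro mult_subgroups generate_is_subgroup) auto
  have K: "K = {h \<otimes> g [^] i |h (i::nat). h \<in> H}"
    unfolding K_def set_mult_def using generate_pow_on_finite_carrier[OF assms(1,4)] by auto
  have Hc: "h \<in> carrier G" if "h \<in> H" for h using that assms(2) subgroup.mem_carrier by metis
  have wd: "\<chi> h * c ^ i = \<chi> h' * c ^ j"
    if h: "h \<in> H" "h' \<in> H" "h \<otimes> g [^] i = h' \<otimes> g [^] j" "i \<le> j" for h h' and i j :: nat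
  proof -
    have "g [^] j = g [^] (j - i) \<otimes> g [^] i" using h(4) assms(4) by (simp add: nat_pow_mult)
    hence "h \<otimes> g [^] i = (h' \<otimes> g [^] (j - i)) \<otimes> g [^] i"
      using h Hc assms(4) by (simp add: m_assoc)
    hence eq: "h = h' \<otimes> g [^] (j - i)" using h Hc assms(4) by simp
    hence "g [^] (j - i) = inv h' \<otimes> h" using h Hc assms(4) by (simp add: m_assoc[symmetric])
    hence gH: "g [^] (j - i) \<in> H"
      using h assms(2) by (simp add: subgroup.m_closed subgroup.m_inv_closed)
    then obtain e where e: "j - i = n * e" using n(2) by blast
    have "g [^] (j - i) = (g [^] n) [^] e" using assms(4) e by (simp add: nat_pow_pow)
    hence "\<chi> (g [^] (j - i)) = c ^ (j - i)"
      using character_on_pow[OF assms(3,2) n(1)] n(3) e by (simp add: power_mult)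
    hence "\<chi> h = \<chi> h' * c ^ (j - i)" using eq character_on_mult[OF assms(3) h(2) gH] by simp
    thus ?thesis using h(4) by (simp add: power_add[symmetric])
  qed
  define \<psi> where "\<psi> x = (SOME y. \<exists>h\<in>H. \<exists>i::nat. x = h \<otimes> g [^] i \<and> y = \<chi> h * c ^ i)" for x
  have \<psi>: "\<psi> (h \<otimes> g [^] i) = \<chi> h * c ^ i" if h: "h \<in> H" for h and i :: nat
  proof -
    have "\<exists>h'\<in>H. \<exists>j::nat. h \<otimes> g [^] i = h' \<otimes> g [^] j \<and> \<psi> (h \<otimes> g [^] i) = \<chi> h' * c ^ j"
      unfolding \<psi>_def by (rule someI_ex) (use h in blast)
    then obtain h' j where j: "h' \<in> H" "h \<otimes> g [^] i = h' \<otimes> g [^] (j::nat)"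
      "\<psi> (h \<otimes> g [^] i) = \<chi> h' * c ^ j" by blast
    show ?thesis using wd[OF h j(1,2)] wd[OF j(1) h j(2)[symmetric]] j(3) by (metis nat_le_linear)
  qed
  have one: "\<one> \<in> H" using assms(2) subgroup.one_closed by blast
  have ext: "\<psi> h = \<chi> h" if "h \<in> H" for h using \<psi>[OF that, of 0] Hc[OF that] by simp
  have "\<psi> (x \<otimes> y) = \<psi> x * \<psi> y" if xy: "x \<in> K" "y \<in> K" for x y
  proof -
    obtain h i where hi: "h \<in> H" "x = h \<otimes> g [^] (i::nat)" using xy(1) by (auto simp: K)
    obtain h' j where hj: "h' \<in> H" "y = h' \<otimes> g [^] (j::nat)" using xy(2) by (auto simp: K)
    note h = hi hj
    have "x \<otimes> y = (h \<otimes> h') \<otimes> g [^] (i + j)"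
      using h Hc assms(4) by (simp add: nat_pow_mult[symmetric] m_ac)
    hence "\<psi> (x \<otimes> y) = \<chi> (h \<otimes> h') * c ^ (i + j)"
      using \<psi>[of "h \<otimes> h'" "i + j"] h assms(2) by (simp add: subgroup.m_closed)
    also have "\<dots> = \<psi> x * \<psi> y"
      using h \<psi> character_on_mult[OF assms(3) h(1,3)] by (simp add: power_add)
    finally show ?thesis .
  qed
  hence "character_on G K \<psi>"
    unfolding character_on_def using ext[OF one] character_on_one[OF assms(3)] by simp
  moreover have "\<psi> g = c"
    using \<psi>[OF one, of 1] assms(4) character_on_one[OF assms(3)] by simp
  moreover have "h \<in> K" if h: "h \<in> H" for h
  proof -
    have "h = h \<otimes> g [^] (0::nat)" using Hc[OF h] by simp
    thus ?thesis unfolding K using h by blast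
  qed
  moreover have "g \<in> K"
    unfolding K using one assms(4) by (auto intro!: exI[of _ \<one>] exI[of _ "1::nat"])
  ultimately show ?thesis using that[of K \<psi>] sub ext by blast
qed

text \<open>One element is adjoined at a time; the required \<open>c\<close> exists because a
  nonzero complex number has n-th roots.\<close>

lemma extend_character:
  assumes "finite (carrier G)" "subgroup H G" "character_on G H \<chi>"
  shows "\<exists>\<psi>. character_on G (carrier G) \<psi> \<and> (\<forall>h\<in>H. \<psi> h = \<chi> h)"
  using assms(2,3)
proof (induction "card (carrier G) - card H" arbitrary: H \<chi> rule: less_induct)
  case less
  show ?case
  proof (cases "H = carrier G")
    case True
    thus ?thesis using less.prems by blast
  next
    case False
    have sub: "H \<subseteq> carrier G" using less.prems(1) subgroup.subset by blast
    then obtain g where g: "g \<in> carrier G" "g \<notin> H" using False by blast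
    obtain n :: nat where n: "n > 0" "g [^] n \<in> H" "\<And>i::nat. g [^] i \<in> H \<Longrightarrow> n dvd i"
      using least_power_in_subgroup[OF assms(1) less.prems(1) g(1)] by blast
    have "\<chi> (g [^] n) \<noteq> 0" using character_on_inv[OF less.prems(2,1) n(2)] by auto
    hence "card {z. z ^ n = \<chi> (g [^] n)} = n" using n(1) by (intro card_nth_roots)
    then obtain c where c: "c ^ n = \<chi> (g [^] n)" using n(1) by (metis (mono_tags) card.empty empty_Collect_eq less_irrefl)
    obtain K \<psi> where K: "subgroup K G" "H \<subseteq> K" "g \<in> K" "character_on G K \<psi>"
      "\<And>h. h \<in> H \<Longrightarrow> \<psi> h = \<chi> h"
      using extend_character_by_element[OF assms(1) less.prems g(1) n(2,3) c] by metis
    have Kc: "K \<subseteq> carrier G" using K(1) subgroup.subset by blast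
    have "H \<subset> K" using K g by blast
    hence "card H < card K" using Kc assms(1) by (meson finite_subset psubset_card_mono)
    moreover have "card K \<le> card (carrier G)" using Kc assms(1) card_mono by blast
    ultimately have "card (carrier G) - card K < card (carrier G) - card H" by linarith
    from less.hyps[OF this K(1,4)] K(2,5) show ?thesis by (metis subsetD)
  qed
qed

text \<open>The order \<open>n\<close> of \<open>g\<close> modulo \<open>H\<close> exceeds 1, so the
  trivial character of \<open>H\<close> extends with \<open>g\<close> sent to an n-th root of unity
  other than 1, and then to all of \<open>G\<close>.\<close>

lemma separating_character:
  assumes "finite (carrier G)" "subgroup H G" "g \<in> carrier G" "g \<notin> H"
  obtains \<psi> where "character_on G (carrier G) \<psi>" "\<And>h. h \<in> H \<Longrightarrow> \<psi> h = 1" "\<psi> g \<noteq> 1"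
proof -
  obtain n :: nat where n: "n > 0" "g [^] n \<in> H" "\<And>i::nat. g [^] i \<in> H \<Longrightarrow> n dvd i"
    using least_power_in_subgroup[OF assms(1-3)] by blast
  have "n \<noteq> 1" using n(2) assms(3,4) by auto
  hence "card {z::complex. z ^ n = 1} > 1" using n(1) card_roots_unity_eq[of n] by simp
  hence "\<not> {z::complex. z ^ n = 1} \<subseteq> {1}"
    by (metis card_mono finite.emptyI finite_insert is_singletonI is_singleton_altdef leD)
  then obtain c :: complex where c: "c ^ n = 1" "c \<noteq> 1" by blast
  have "character_on G H (\<lambda>_. 1)" by (simp add: character_on_def)
  then obtain K \<psi> where K: "subgroup K G" "H \<subseteq> K" "g \<in> K" "character_on G K \<psi>"
      "\<And>h. h \<in> H \<Longrightarrow> \<psi> h = 1" "\<psi> g = c"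
    using extend_character_by_element[OF assms(1,2) _ assms(3) n(2,3), of "\<lambda>_. 1" c] c(1) by metis
  from extend_character[OF assms(1) K(1,4)] obtain \<phi> where
    "character_on G (carrier G) \<phi>" "\<forall>h\<in>K. \<phi> h = \<psi> h" by blast
  thus ?thesis using that[of \<phi>] K c(2) by (metis subsetD)
qed

text \<open>Orthogonality of the characters trivial on \<open>H\<close> expresses the indicator of
  \<open>H\<close>. If all nontrivial ones vanish on \<open>D\<close>, then \<open>D\<close> meets
  every coset of \<open>H\<close> in the same number of points.\<close>

lemma order_dvd_card_mult_of_vanishing_characters:
  assumes "finite (carrier G)" "subgroup H G" "D \<subseteq> carrier G"
    and vanish: "\<And>\<psi> g. character_on G (carrier G) \<psi> \<Longrightarrow> (\<And>h. h \<in> H \<Longrightarrow> \<psi> h = 1) \<Longrightarrow>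
      g \<in> carrier G \<Longrightarrow> \<psi> g \<noteq> 1 \<Longrightarrow> (\<Sum>x\<in>D. \<psi> x) = 0"
  shows "order G dvd card D * card H"
proof -
  \<comment> \<open>Values outside the carrier are fixed by extensionality, which makes
    \<open>X\<close> finite.\<close>
  define X where "X = {\<psi> \<in> extensional (carrier G). character_on G (carrier G) \<psi> \<and> (\<forall>h\<in>H. \<psi> h = 1)}"
  have Hc: "H \<subseteq> carrier G" using assms(2) subgroup.subset by blast
  have finD: "finite D" using assms(1,3) finite_subset by blast
  have "X \<subseteq> (carrier G \<rightarrow>\<^sub>E {z::complex. z ^ order G = 1})"
    by (auto simp: X_def PiE_def character_root_of_unity)
  moreover have "finite (carrier G \<rightarrow>\<^sub>E {z::complex. z ^ order G = 1})"
    using assms(1) by (intro finite_PiE finite_nth_roots) (auto simp: order_gt_0_iff_finite)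
  ultimately have finX: "finite X" by (rule finite_subset)
  define \<epsilon> where "\<epsilon> = restrict (\<lambda>_. 1 :: complex) (carrier G)"
  have \<epsilon>: "\<epsilon> \<in> X" using Hc by (auto simp: X_def \<epsilon>_def character_on_def)
  have orth: "(\<Sum>\<psi>\<in>X. \<psi> g) = (if g \<in> H then of_nat (card X) else 0)" if g: "g \<in> carrier G" for g
  proof (cases "g \<in> H")
    case True
    thus ?thesis by (simp add: X_def)
  next
    case False
    obtain \<phi> where \<phi>: "character_on G (carrier G) \<phi>" "\<And>h. h \<in> H \<Longrightarrow> \<phi> h = 1" "\<phi> g \<noteq> 1"
      using separating_character[OF assms(1,2) g False] by blast
    have nz: "\<phi> x * \<phi> (inv x) = 1" if "x \<in> carrier G" for x
      by (rule character_on_inv[OF \<phi>(1) subgroup_self that])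
    \<comment> \<open>Multiplication by \<open>\<phi>\<close> permutes \<open>X\<close>, so the sum
      at \<open>g\<close> equals itself times \<open>\<phi> g\<close>, which is not 1.\<close>
    have "bij_betw (\<lambda>\<psi>. restrict (\<lambda>x. \<phi> x * \<psi> x) (carrier G)) X X"
    proof (rule bij_betwI[where g = "\<lambda>\<psi>. restrict (\<lambda>x. \<phi> (inv x) * \<psi> x) (carrier G)"])
      show "(\<lambda>\<psi>. restrict (\<lambda>x. \<phi> x * \<psi> x) (carrier G)) \<in> X \<rightarrow> X"
        using \<phi> Hc by (auto simp: X_def character_on_def)
      show "(\<lambda>\<psi>. restrict (\<lambda>x. \<phi> (inv x) * \<psi> x) (carrier G)) \<in> X \<rightarrow> X"
        using \<phi> Hc subgroup.m_inv_closed[OF assms(2)] by (auto simp: X_def character_on_def inv_mult)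
      show "restrict (\<lambda>x. \<phi> (inv x) * restrict (\<lambda>x. \<phi> x * \<psi> x) (carrier G) x) (carrier G) = \<psi>"
        if "\<psi> \<in> X" for \<psi>
        using that nz by (intro extensionalityI[of _ "carrier G"]) (auto simp: X_def mult_ac)
      show "restrict (\<lambda>x. \<phi> x * restrict (\<lambda>x. \<phi> (inv x) * \<psi> x) (carrier G) x) (carrier G) = \<psi>"
        if "\<psi> \<in> X" for \<psi>
        using that nz by (intro extensionalityI[of _ "carrier G"]) (auto simp: X_def mult_ac)
    qed
    from sum.reindex_bij_betw[OF this, of "\<lambda>\<psi>. \<psi> g"]
    have "(\<Sum>\<psi>\<in>X. \<psi> g) = \<phi> g * (\<Sum>\<psi>\<in>X. \<psi> g)" using g by (simp add: sum_distrib_left)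
    hence "(\<Sum>\<psi>\<in>X. \<psi> g) = 0" using \<phi>(3) by (metis mult_cancel_right1)
    thus ?thesis using False by simp
  qed
  have unif: "card X * card {x \<in> D. x \<otimes> inv y \<in> H} = card D" if y: "y \<in> carrier G" for y
  proof -
    \<comment> \<open>The set counts the points of \<open>D\<close> in the coset of
      \<open>y\<close>; after the sums are swapped, only the trivial character
      \<open>\<epsilon>\<close> contributes.\<close>
    have "of_nat (card X * card {x \<in> D. x \<otimes> inv y \<in> H})
        = (\<Sum>x\<in>D. if x \<otimes> inv y \<in> H then of_nat (card X) else (0::complex))"
      using finD by (simp add: sum.If_cases Int_def)
    also have "\<dots> = (\<Sum>x\<in>D. \<Sum>\<psi>\<in>X. \<psi> (x \<otimes> inv y))"
      using assms(3) y by (intro sum.cong) (auto simp: orth)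
    also have "\<dots> = (\<Sum>\<psi>\<in>X. \<Sum>x\<in>D. \<psi> (x \<otimes> inv y))" by (rule sum.swap)
    also have "\<dots> = (\<Sum>\<psi>\<in>X. \<psi> (inv y) * (\<Sum>x\<in>D. \<psi> x))"
    proof (intro sum.cong refl)
      fix \<psi> assume "\<psi> \<in> X"
      hence "\<psi> (x \<otimes> inv y) = \<psi> (inv y) * \<psi> x" if "x \<in> D" for x
        using that assms(3) y by (auto simp: X_def character_on_def)
      thus "(\<Sum>x\<in>D. \<psi> (x \<otimes> inv y)) = \<psi> (inv y) * (\<Sum>x\<in>D. \<psi> x)" by (simp add: sum_distrib_left)
    qed
    also have "\<dots> = (\<Sum>\<psi>\<in>X. if \<psi> = \<epsilon> then of_nat (card D) else 0)"
    proof (intro sum.cong refl)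
      fix \<psi> assume \<psi>: "\<psi> \<in> X"
      show "\<psi> (inv y) * (\<Sum>x\<in>D. \<psi> x) = (if \<psi> = \<epsilon> then of_nat (card D) else 0)"
      proof (cases "\<psi> = \<epsilon>")
        case True
        have "(\<Sum>x\<in>D. \<epsilon> x) = (\<Sum>x\<in>D. 1)" using assms(3) by (intro sum.cong) (auto simp: \<epsilon>_def)
        thus ?thesis using True y by (simp add: \<epsilon>_def)
      next
        case False
        have "\<exists>g\<in>carrier G. \<psi> g \<noteq> 1"
        proof (rule ccontr)
          assume "\<not> (\<exists>g\<in>carrier G. \<psi> g \<noteq> 1)"
          hence "\<psi> = \<epsilon>" using \<psi> \<epsilon> by (intro extensionalityI[of _ "carrier G"]) (auto simp: X_def \<epsilon>_def)
          thus False using False by blast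
        qed
        then obtain g where "g \<in> carrier G" "\<psi> g \<noteq> 1" by blast
        hence "(\<Sum>x\<in>D. \<psi> x) = 0" using vanish[of \<psi> g] \<psi> by (auto simp: X_def)
        thus ?thesis using False by simp
      qed
    qed
    also have "\<dots> = of_nat (card D)" using \<epsilon> finX by simp
    finally show ?thesis by (simp only: of_nat_eq_iff)
  qed
  define c where "c = card {x \<in> D. x \<otimes> inv \<one> \<in> H}"
  have "card X > 0" using \<epsilon> finX by (auto simp: card_gt_0_iff)
  hence const: "card {x \<in> D. x \<otimes> inv y \<in> H} = c" if "y \<in> carrier G" for y
    using unif[OF that] unif[OF one_closed] unfolding c_def by (metis mult_left_cancel less_irrefl)
  have fibre: "card {y \<in> carrier G. x \<otimes> inv y \<in> H} = card H" if x: "x \<in> carrier G" for x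
  proof -
    have "bij_betw (\<lambda>h. inv h \<otimes> x) H {y \<in> carrier G. x \<otimes> inv y \<in> H}"
    proof (rule bij_betwI[where g = "\<lambda>y. x \<otimes> inv y"])
      show "(\<lambda>h. inv h \<otimes> x) \<in> H \<rightarrow> {y \<in> carrier G. x \<otimes> inv y \<in> H}"
      proof
        fix h assume h: "h \<in> H"
        hence hc: "h \<in> carrier G" using Hc by blast
        have "x \<otimes> inv (inv h \<otimes> x) = h" using x hc by (simp add: inv_mult m_lcomm)
        thus "inv h \<otimes> x \<in> {y \<in> carrier G. x \<otimes> inv y \<in> H}" using h hc x by simp
      qed
      show "x \<otimes> inv (inv h \<otimes> x) = h" if "h \<in> H" for h
        using x that Hc by (simp add: inv_mult m_lcomm subset_iff)
      show "inv (x \<otimes> inv y) \<otimes> x = y" if "y \<in> {y \<in> carrier G. x \<otimes> inv y \<in> H}" for y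
        using x that by (simp add: inv_mult m_assoc m_lcomm[of "inv x"])
    qed auto
    from bij_betw_same_card[OF this] show ?thesis by simp
  qed
  \<comment> \<open>Double counting of the pairs (x, y) with x in \<open>D\<close> and
    \<open>x \<otimes> inv y\<close> in \<open>H\<close>.\<close>
  have "order G * c = (\<Sum>y\<in>carrier G. card {x \<in> D. x \<otimes> inv y \<in> H})"
    by (simp add: const order_def)
  also have "\<dots> = (\<Sum>x\<in>D. card {y \<in> carrier G. x \<otimes> inv y \<in> H})"
    unfolding card_eq_sum sum.inter_filter[OF assms(1)] sum.inter_filter[OF finD] by (rule sum.swap)
  also have "\<dots> = card D * card H" using assms(3) fibre by (simp add: subset_iff)
  finally show ?thesis by (metis dvd_triv_left)
qed

lemma subgroup_nat_pow_kernel: "subgroup {x \<in> carrier G. x [^] (n::nat) = \<one>} G"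
  by (rule subgroupI) (auto simp: nat_pow_distrib nat_pow_inv)

lemma subgroup_nat_pow_image: "subgroup ((\<lambda>x. x [^] (n::nat)) ` carrier G) G"
proof (rule subgroupI)
  fix a b assume "a \<in> (\<lambda>x. x [^] n) ` carrier G" "b \<in> (\<lambda>x. x [^] n) ` carrier G"
  thus "a \<otimes> b \<in> (\<lambda>x. x [^] n) ` carrier G"
    by (auto simp: nat_pow_distrib[symmetric])
qed (auto simp: nat_pow_inv[symmetric])

text \<open>Take for \<open>H\<close> the elements killed by \<open>w\<close>. Every x^(p^a) lies in
  \<open>H\<close>, so characters trivial on \<open>H\<close> have values of p-power order; and
  \<open>card H\<close> is prime to p, so p^a must divide \<open>card D\<close>.\<close>

lemma prime_power_dvd_card_of_vanishing_characters:
  assumes "finite (carrier G)" "prime p" "order G = p ^ a * w" "\<not> p dvd w" "D \<subseteq> carrier G"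
    and vanish: "\<And>\<psi> g. character_on G (carrier G) \<psi> \<Longrightarrow>
      (\<And>x. x \<in> carrier G \<Longrightarrow> \<psi> x ^ (p ^ a) = 1) \<Longrightarrow>
      g \<in> carrier G \<Longrightarrow> \<psi> g \<noteq> 1 \<Longrightarrow> (\<Sum>x\<in>D. \<psi> x) = 0"
  shows "p ^ a dvd card D"
proof -
  define H where "H = {x \<in> carrier G. x [^] w = \<one>}"
  have H: "subgroup H G" unfolding H_def by (rule subgroup_nat_pow_kernel)
  have "order G dvd card D * card H"
  proof (rule order_dvd_card_mult_of_vanishing_characters[OF assms(1) H assms(5)])
    fix \<psi> g assume \<psi>: "character_on G (carrier G) \<psi>" "\<And>h. h \<in> H \<Longrightarrow> \<psi> h = 1"
      and g: "g \<in> carrier G" "\<psi> g \<noteq> 1"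
    have "\<psi> x ^ (p ^ a) = 1" if x: "x \<in> carrier G" for x
    proof -
      have "x [^] (p ^ a) \<in> H" using x pow_order_eq_1[OF x] assms(3) by (simp add: H_def nat_pow_pow)
      thus ?thesis using \<psi>(2) character_on_pow[OF \<psi>(1) subgroup_self x] by metis
    qed
    thus "(\<Sum>x\<in>D. \<psi> x) = 0" using vanish \<psi>(1) g by blast
  qed
  hence dvd: "p ^ a dvd card D * card H" using assms(3) by (metis dvd_mult_left)
  \<comment> \<open>By Cauchy, \<open>H\<close> would contain a non-identity element whose order
    divides both p and \<open>w\<close>.\<close>
  have "\<not> p dvd card H"
  proof
    assume "p dvd card H"
    moreover have "group (G\<lparr>carrier := H\<rparr>)" using H by (simp add: subgroup_imp_group)
    moreover have "finite H" using assms(1) by (simp add: H_def)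
    ultimately obtain x where x: "x \<in> H" "x \<noteq> \<one>" "x [^] p = \<one>"
      using group.cauchy_element[of "G\<lparr>carrier := H\<rparr>" p] assms(2)
      by (auto simp: order_def nat_pow_consistent[symmetric])
    have "ord x dvd p" "ord x dvd w" using x by (auto simp: H_def pow_eq_id)
    hence "ord x dvd 1" using assms(2,4) by (metis coprime_common_divisor_nat prime_imp_coprime coprime_def)
    hence "x [^] (1::nat) = \<one>" using x pow_ord_eq_1[of x] by (simp add: H_def)
    thus False using x by (simp add: H_def)
  qed
  hence "coprime (p ^ a) (card H)" using assms(2) prime_imp_coprime coprime_power_left_iff by blast
  thus ?thesis using dvd by (simp add: coprime_dvd_mult_left_iff)
qed

text \<open>By Cauchy the p-th power map is not injective, hence by finiteness not surjective; a
  character that is trivial on its image but not at a missed \<open>g\<close> is the one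
  sought.\<close>

lemma exists_character_of_prime_order:
  assumes "finite (carrier G)" "prime p" "p dvd order G"
  obtains \<psi> g where "character_on G (carrier G) \<psi>" "\<And>x. x \<in> carrier G \<Longrightarrow> \<psi> x ^ p = 1"
    "g \<in> carrier G" "\<psi> g \<noteq> 1"
proof -
  let ?f = "\<lambda>x. x [^] p"
  obtain x where x: "x \<in> carrier G" "x \<noteq> \<one>" "x [^] p = \<one>"
    using cauchy_element[OF assms(2,1,3)] by blast
  have "\<not> inj_on ?f (carrier G)" using x inj_onD[of ?f "carrier G" x \<one>] by auto
  hence "?f ` carrier G \<noteq> carrier G" using assms(1) by (metis eq_card_imp_inj_on)
  then obtain g where g: "g \<in> carrier G" "g \<notin> ?f ` carrier G" by auto
  obtain \<psi> where \<psi>: "character_on G (carrier G) \<psi>" "\<And>h. h \<in> ?f ` carrier G \<Longrightarrow> \<psi> h = 1" "\<psi> g \<noteq> 1"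
    using separating_character[OF assms(1) subgroup_nat_pow_image g] by blast
  have "\<psi> x ^ p = 1" if x: "x \<in> carrier G" for x
    using \<psi>(2)[OF imageI[OF x]] character_on_pow[OF \<psi>(1) subgroup_self x] by simp
  thus ?thesis using that \<psi> g by blast
qed

end

section \<open>Character sums of strong external difference families\<close>

text \<open>Each \<open>\<psi> x\<close> is a power of one primitive N-th root of unity, and
  \<open>f\<close> collects the exponents. The value at 1 records the size of \<open>A\<close> for
  reduction modulo p.\<close>

lemma sum_character_eq_eval_int_poly:
  assumes "N > 0" "finite A" "\<And>x. x \<in> A \<Longrightarrow> \<psi> x ^ N = 1"
  obtains f where "eval_int_poly f (cis (2 * pi / real N)) = (\<Sum>x\<in>A. \<psi> x)" "poly f 1 = int (card A)"
proof -
  have "\<exists>e. \<psi> x = cis (2 * pi / real N) ^ e" if x: "x \<in> A" for x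
  proof -
    have "\<psi> x \<in> (\<lambda>k. cis (2 * pi * real k / real N)) ` {..<N}"
      using bij_betw_imp_surj_on[OF bij_betw_roots_unity[OF assms(1)]] assms(3)[OF x] by blast
    then obtain e where "\<psi> x = cis (2 * pi * real e / real N)" by blast
    hence "\<psi> x = cis (2 * pi / real N) ^ e" by (simp add: DeMoivre mult_ac)
    thus ?thesis by blast
  qed
  then obtain e where e: "\<And>x. x \<in> A \<Longrightarrow> \<psi> x = cis (2 * pi / real N) ^ e x" by metis
  define f where "f = (\<Sum>x\<in>A. monom (1::int) (e x))"
  have "eval_int_poly f (cis (2 * pi / real N)) = (\<Sum>x\<in>A. \<psi> x)"
    using assms(2) e unfolding f_def
    by (induction A rule: finite_induct) (simp_all add: eval_int_poly_simps(1,6) poly_monom)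
  moreover have "poly f 1 = int (card A)" by (simp add: f_def poly_sum poly_monom)
  ultimately show ?thesis by (rule that)
qed

text \<open>Summing \<open>\<psi>\<close> over the external differences gives the left side by
  multiplicativity. Counting by multiplicity gives lam times the sum over all non-identity elements,
  which is -1.\<close>

lemma sum_character_external_differences:
  assumes "comm_group G" "finite (carrier G)" "is_SEDF G v m k lam D" "j \<in> {1..m}"
    and \<psi>: "character_on G (carrier G) \<psi>" "g \<in> carrier G" "\<psi> g \<noteq> 1"
  defines "S \<equiv> \<lambda>l. \<Sum>x\<in>D l. \<psi> x"
  shows "((\<Sum>l=1..m. S l) - S j) * cnj (S j) = - of_nat lam"
proof -
  interpret comm_group G by (rule assms(1))
  define T where "T = (SIGMA l:{1..m}-{j}. D l \<times> D j)"
  define f where "f = (\<lambda>(l::nat, x, y). x \<otimes>\<^bsub>G\<^esub> inv\<^bsub>G\<^esub> y)"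
  have Dc: "D l \<subseteq> carrier G" if "l \<in> {1..m}" for l using assms(3) that by (simp add: is_SEDF_def)
  have finD: "finite (D l)" if "l \<in> {1..m}" for l using Dc[OF that] assms(2) finite_subset by blast
  have finT: "finite T" unfolding T_def using finD assms(4) by auto
  have "{(l, x, y). l \<in> {1..m} \<and> l \<noteq> j \<and> x \<in> D l \<and> y \<in> D j} = T" by (auto simp: T_def)
  hence ed: "external_differences G m D j = image_mset f (mset_set T)"
    by (simp add: external_differences_def f_def)
  have cnt: "count (external_differences G m D j) h = card {t \<in> T. f t = h}" for h
  proof -
    have "f -` {h} \<inter> set_mset (mset_set T) = {t \<in> T. f t = h}" using finT by auto
    thus ?thesis using finT by (simp add: ed count_image_mset)
  qed
  have c: "card {t \<in> T. f t = h} = (if h = \<one>\<^bsub>G\<^esub> then 0 else lam)" if "h \<in> carrier G" for h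
    unfolding cnt[symmetric] using assms(3,4) that by (auto simp: is_SEDF_def not_in_iff)
  have fT: "f ` T \<subseteq> carrier G" using Dc assms(4) by (fastforce simp: T_def f_def)
  have "(\<Sum>t\<in>T. \<psi> (f t)) = (\<Sum>h\<in>carrier G. \<Sum>t\<in>{t \<in> T. f t = h}. \<psi> (f t))"
    by (rule sum.group[symmetric, OF finT assms(2) fT])
  also have "\<dots> = (\<Sum>h\<in>carrier G. of_nat lam * \<psi> h - (if h = \<one>\<^bsub>G\<^esub> then of_nat lam else 0))"
    by (intro sum.cong refl) (auto simp: c character_on_one[OF \<psi>(1)])
  also have "\<dots> = - of_nat lam"
    using assms(2) sum_nontrivial_character[OF \<psi>] by (simp add: sum_subtractf sum_distrib_left[symmetric])
  finally have 1: "(\<Sum>t\<in>T. \<psi> (f t)) = - of_nat lam" .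
  have "(\<Sum>t\<in>T. \<psi> (f t)) = (\<Sum>(l, x, y)\<in>T. \<psi> x * cnj (\<psi> y))"
  proof (rule sum.cong[OF refl])
    fix t assume "t \<in> T"
    then obtain l x y where t: "t = (l, x, y)" "l \<in> {1..m}" "x \<in> D l" "y \<in> D j" by (auto simp: T_def)
    hence "x \<in> carrier G" "y \<in> carrier G" using Dc assms(4) by blast+
    thus "\<psi> (f t) = (case t of (l, x, y) \<Rightarrow> \<psi> x * cnj (\<psi> y))"
      using \<psi>(1) assms(2) t(1) by (simp add: f_def character_cnj character_on_mult)
  qed
  also have "\<dots> = (\<Sum>l\<in>{1..m}-{j}. \<Sum>(x, y)\<in>D l \<times> D j. \<psi> x * cnj (\<psi> y))"
    unfolding T_def using finD assms(4) by (subst sum.Sigma) auto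
  also have "\<dots> = (\<Sum>l\<in>{1..m}-{j}. S l * cnj (S j))"
    by (simp add: S_def sum.cartesian_product[symmetric] sum_product)
  also have "\<dots> = ((\<Sum>l=1..m. S l) - S j) * cnj (S j)"
    using assms(4) by (simp add: sum_distrib_right[symmetric] sum_diff1)
  finally show ?thesis using 1 by simp
qed

text \<open>The ratios \<open>S\<^sub>j / s\<close> are real roots of one quadratic \<open>t\<^sup>2 - t = \<rho>\<close> with \<open>\<rho> \<ge> 0\<close>, whose two roots add
  up to 1, as do the ratios themselves; both roots occur because \<open>1/m\<close> would give \<open>\<rho> < 0\<close>.\<close>

lemma exists_nonneg_relation:
  fixes S :: "nat \<Rightarrow> complex" and m :: nat
  defines "s \<equiv> \<Sum>l=1..m. S l"
  assumes "m \<ge> 2" "s \<noteq> 0" and rel: "\<And>j. j \<in> {1..m} \<Longrightarrow> (s - S j) * cnj (S j) = - of_nat lam"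
  obtains i j a b where "i \<in> {1..m}" "j \<in> {1..m}" "a + b = m - 2" "of_nat a * S i + of_nat b * S j = 0"
proof -
  define t where "t l = Re (S l / s)" for l
  \<comment> \<open>Dividing the relation for S_l by |s|^2 gives (1 - x) cnj x = -\<rho> for x = S_l
    / s, so cnj x = |x|^2 - \<rho> is real.\<close>
  define \<rho> where "\<rho> = real lam / (cmod s)\<^sup>2"
  have \<rho>: "\<rho> \<ge> 0" by (simp add: \<rho>_def)
  have St: "S l = of_real (t l) * s" and qt: "t l - (t l)\<^sup>2 = - \<rho>" if l: "l \<in> {1..m}" for l
  proof -
    define x where "x = S l / s"
    have Sx: "S l = x * s" using assms(3) by (simp add: x_def)
    have "(1 - x) * cnj x * (s * cnj s) = - of_nat lam"
      using rel[OF l] unfolding Sx by (simp add: algebra_simps)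
    hence "(1 - x) * cnj x * of_real ((cmod s)\<^sup>2) = - of_nat lam"
      by (simp only: complex_norm_square)
    hence *: "cnj x - x * cnj x = of_real (- \<rho>)"
      using assms(3) by (simp add: \<rho>_def field_simps)
    have "cnj x = of_real (- \<rho> + (cmod x)\<^sup>2)"
      using * by (simp only: of_real_add complex_norm_square) (simp add: algebra_simps)
    hence "Im (cnj x) = 0" by (simp only: Im_complex_of_real)
    hence x: "x = of_real (t l)" by (simp add: t_def x_def[symmetric] complex_eq_iff)
    thus "S l = of_real (t l) * s" using Sx by simp
    have "complex_of_real (t l - (t l)\<^sup>2) = of_real (- \<rho>)"
      using * unfolding x by (simp add: power2_eq_square)
    thus "t l - (t l)\<^sup>2 = - \<rho>" by (simp only: of_real_eq_iff)
  qed
  have "s = (\<Sum>l=1..m. of_real (t l) * s)" using St by (simp add: s_def)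
  hence "s = of_real (\<Sum>l=1..m. t l) * s" by (simp add: sum_distrib_right)
  hence "complex_of_real (\<Sum>l=1..m. t l) = 1" using assms(3) by (metis mult_cancel_right1)
  hence sum1: "(\<Sum>l=1..m. t l) = 1" by (simp only: of_real_eq_1_iff)
  have roots: "t l = t i \<or> t l = 1 - t i" if "l \<in> {1..m}" "i \<in> {1..m}" for l i
  proof -
    have "(t l - t i) * (1 - t l - t i) = 0"
      using qt[OF that(1)] qt[OF that(2)] by (simp add: algebra_simps power2_eq_square)
    thus ?thesis by auto
  qed
  have 1: "1 \<in> {1..m}" using assms(2) by simp
  have "\<exists>j\<in>{1..m}. t j \<noteq> t 1"
  proof (rule ccontr)
    assume "\<not> (\<exists>j\<in>{1..m}. t j \<noteq> t 1)"
    hence "(\<Sum>l=1..m. t l) = (\<Sum>l=1..m. t 1)" by (intro sum.cong) blast+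
    hence m: "real m * t 1 = 1" using sum1 by simp
    hence "0 < real m * t 1" by simp
    hence "t 1 > 0" using assms(2) by (simp add: zero_less_mult_iff)
    hence "real 2 * t 1 \<le> real m * t 1" using assms(2) by (intro mult_right_mono) auto
    hence "t 1 < 1" using m by simp
    hence "t 1 * (1 - t 1) > 0" using \<open>t 1 > 0\<close> by simp
    thus False using qt[OF 1] \<rho> by (simp add: algebra_simps power2_eq_square)
  qed
  then obtain j where j: "j \<in> {1..m}" "t j \<noteq> t 1" by blast
  define P where "P = {l \<in> {1..m}. t l = t 1}"
  define Q where "Q = {l \<in> {1..m}. t l \<noteq> t 1}"
  have PQ: "{1..m} = P \<union> Q" "P \<inter> Q = {}" "finite P" "finite Q" by (auto simp: P_def Q_def)
  have tj: "t j = 1 - t 1" using roots[OF j(1) 1] j(2) by blast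
  have tQ: "t l = t j" if "l \<in> Q" for l
  proof -
    have l: "l \<in> {1..m}" "t l \<noteq> t 1" using that by (simp_all add: Q_def)
    show ?thesis using roots[OF l(1) 1] l(2) unfolding tj by blast
  qed
  have "1 \<in> P" "j \<in> Q" using 1 j by (simp_all add: P_def Q_def)
  hence "card P > 0" "card Q > 0" using PQ(3,4) card_gt_0_iff by blast+
  \<comment> \<open>Setting aside one index from each class removes \<open>t 1 + t j = 1\<close>,
    the whole sum; the remaining \<open>a\<close> and \<open>b\<close> ratios therefore add up to
    0.\<close>
  then obtain a b where ab: "card P = Suc a" "card Q = Suc b" by (meson gr0_implies_Suc)
  have "m = card P + card Q" using card_Un_disjoint[OF PQ(3,4,2)] PQ(1)[symmetric] by simp
  hence "a + b = m - 2" using ab by simp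
  moreover have "real a * t 1 + real b * t j = 0"
  proof -
    have "(\<Sum>l=1..m. t l) = (\<Sum>l\<in>P. t l) + (\<Sum>l\<in>Q. t l)"
      unfolding PQ(1) by (rule sum.union_disjoint[OF PQ(3,4,2)])
    also have "(\<Sum>l\<in>P. t l) = real (card P) * t 1" by (simp add: P_def)
    also have "(\<Sum>l\<in>Q. t l) = real (card Q) * t j" using tQ by simp
    finally have "real (Suc a) * t 1 + real (Suc b) * t j = 1" using sum1 ab by simp
    hence "real a * t 1 + real b * t j + (t 1 + t j) = 1" by (simp add: algebra_simps)
    thus ?thesis using tj by linarith
  qed
  hence "of_real (real a * t 1 + real b * t j) * s = 0" by simp
  hence "of_nat a * S 1 + of_nat b * S j = 0"
    unfolding St[OF 1] St[OF j(1)] by (simp add: algebra_simps)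
  ultimately show ?thesis using that 1 j(1) by blast
qed

text \<open>The relation c S_i + d S_j = 0 lifts to an integer polynomial vanishing at a p-power
  root of unity; its value at 1 is k (c + d) = k (m - 2).\<close>

lemma nonzero_character_sum_imp_dvd:
  assumes "comm_group G" "finite (carrier G)" "is_SEDF G v m k lam D" "m \<ge> 3" "prime p"
    and \<psi>: "character_on G (carrier G) \<psi>" "g \<in> carrier G" "\<psi> g \<noteq> 1"
    and root: "\<And>x. x \<in> carrier G \<Longrightarrow> \<psi> x ^ (p ^ b) = 1"
    and nz: "(\<Sum>l=1..m. \<Sum>x\<in>D l. \<psi> x) \<noteq> 0"
  shows "p dvd k * (m - 2)"
proof -
  define z where "z = cis (2 * pi / real (p ^ b))"
  have N: "p ^ b > 0" using assms(5) by (simp add: prime_gt_0_nat)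
  have z: "z ^ (p ^ b) = 1" unfolding z_def DeMoivre using N by simp
  have Dc: "D l \<subseteq> carrier G" "card (D l) = k" if "l \<in> {1..m}" for l
    using assms(3) that by (simp_all add: is_SEDF_def)
  have poly: "\<exists>f. eval_int_poly f z = (\<Sum>x\<in>D l. \<psi> x) \<and> poly f 1 = int k" if l: "l \<in> {1..m}" for l
  proof -
    have "finite (D l)" using Dc(1)[OF l] assms(2) finite_subset by blast
    thus ?thesis
      using sum_character_eq_eval_int_poly[OF N, of "D l" \<psi>] root Dc[OF l] unfolding z_def by (metis subsetD)
  qed
  have m2: "m \<ge> 2" using assms(4) by simp
  obtain i j c d where ij: "i \<in> {1..m}" "j \<in> {1..m}" "c + d = m - 2"
    "of_nat c * (\<Sum>x\<in>D i. \<psi> x) + of_nat d * (\<Sum>x\<in>D j. \<psi> x) = 0"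
    by (rule exists_nonneg_relation[OF m2 nz sum_character_external_differences[OF assms(1-3) _ \<psi>]])
  obtain f h where f: "eval_int_poly f z = (\<Sum>x\<in>D i. \<psi> x)" "poly f 1 = int k"
    and h: "eval_int_poly h z = (\<Sum>x\<in>D j. \<psi> x)" "poly h 1 = int k"
    using poly ij(1,2) by metis
  have "eval_int_poly (of_nat c * f + of_nat d * h) z = 0"
    using ij(4) f(1) h(1) by (simp only: eval_int_poly_simps)
  from vanishing_prime_power_root_imp_dvd[OF assms(5) z this]
  have "int p dvd int (k * (c + d))" using f(2) h(2) by (simp add: algebra_simps)
  thus ?thesis unfolding ij(3) by (simp only: int_dvd_int_iff)
qed

text \<open>Once \<open>q = p\<close> is excluded, the q-part of p is trivial, so self-conjugacy
  gives -1 as a power of q modulo p itself and the norm descent applies.\<close>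

lemma even_exponent_of_norm:
  assumes "prime p" "odd p" "prime q" "q dvd n" "finite A" "\<not> p dvd card A"
    and "\<And>x. x \<in> A \<Longrightarrow> \<psi> x ^ p = 1" "(\<Sum>x\<in>A. \<psi> x) * cnj (\<Sum>x\<in>A. \<psi> x) = of_nat n"
    and "self_conjugate q p" "exactly_divides q u n"
  shows "even u"
proof -
  define z where "z = cis (2 * pi / real p)"
  have p: "p > 2" using assms(1,2) prime_ge_2_nat[of p] by (cases "p = 2") auto
  have z: "z ^ p = 1" unfolding z_def DeMoivre using p by simp
  obtain f where f: "eval_int_poly f z = (\<Sum>x\<in>A. \<psi> x)" "poly f 1 = int (card A)"
    using sum_character_eq_eval_int_poly[of p A \<psi>] assms(5,7) p unfolding z_def by auto
  have norm: "eval_int_poly f z * cnj (eval_int_poly f z) = of_nat n" using assms(8) f(1) by simp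
  have "q \<noteq> p"
  proof
    assume qp: "q = p"
    \<comment> \<open>With conjugation written as z -> z^(p-1), \<open>h\<close> vanishes at
      \<open>z\<close> and takes the value (card A)^2 - n at 1.\<close>
    define h where "h = f * pcompose f (monom 1 (p - 1)) - [:int n:]"
    have "[int (p - 1) = - 1] (mod int p)" using p by (simp add: cong_iff_dvd_diff of_nat_diff)
    hence "cnj z = z ^ (p - 1)" using cnj_root_of_unity_power[OF z] p by simp
    hence "eval_int_poly h z = 0"
      using norm by (simp add: h_def eval_int_poly_simps eval_int_poly_cnj poly_monom)
    hence "int p dvd poly h 1" using vanishing_prime_power_root_imp_dvd[OF assms(1), of z 1] z by simp
    hence "int p dvd int (card A) * int (card A) - int n"
      by (simp add: h_def f(2) poly_pcompose poly_monom)
    moreover have "int p dvd int n" using assms(4) qp by simp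
    ultimately have "int p dvd (int (card A) * int (card A) - int n) + int n" by (rule dvd_add)
    hence "int p dvd int (card A * card A)" by simp
    hence "p dvd card A * card A" by (simp only: int_dvd_int_iff)
    thus False using assms(1,6) by (simp add: prime_dvd_mult_iff)
  qed
  obtain s w r where w: "p = q ^ s * w" "[int q ^ r = - 1] (mod int w)"
    using assms(9) by (auto simp: self_conjugate_def)
  have "s = 0"
  proof (rule ccontr)
    assume "s \<noteq> 0"
    hence "q dvd p" using w(1) by (simp add: dvd_power)
    thus False using assms(1,3) \<open>q \<noteq> p\<close> by (simp add: primes_dvd_imp_eq)
  qed
  hence "[int q ^ r = - 1] (mod int p)" using w by simp
  from self_conjugate_norm_even_exponent[OF assms(3) z p this norm assms(10)] show ?thesis .
qed

theorem theorem4p4: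
  fixes G :: "('a, 'b) monoid_scheme" and v m k lam p a q :: nat
  assumes "comm_group G" and "finite (carrier G)" and "order G = v"
    and "\<exists>D. is_SEDF G v m k lam D"
    and "m \<ge> 3"
    and "prime p" and "odd p" and "a \<ge> 1" and "exactly_divides p a v"
    and "prime q" and "q dvd lam"
  shows "[k * (m - 2) = 0] (mod p) \<or>
    (p ^ a dvd m * k \<and>
     (\<forall>u. self_conjugate q p \<and> exactly_divides q u lam \<longrightarrow> even u))"
proof (cases "p dvd k * (m - 2)")
  case True
  thus ?thesis by (simp add: cong_0_iff)
next
  case False
  interpret comm_group G by (rule assms(1))
  obtain D where D: "is_SEDF G v m k lam D" using assms(4) by blast
  define U where "U = (\<Union>l\<in>{1..m}. D l)"
  have Dc: "D l \<subseteq> carrier G" "card (D l) = k" if "l \<in> {1..m}" for l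
    using D that by (simp_all add: is_SEDF_def)
  have finD: "finite (D l)" if "l \<in> {1..m}" for l using Dc(1)[OF that] assms(2) finite_subset by blast
  have disj: "\<forall>i\<in>{1..m}. \<forall>j\<in>{1..m}. i \<noteq> j \<longrightarrow> D i \<inter> D j = {}"
    using D by (auto simp: is_SEDF_def disjoint_family_on_def)
  have "card U = (\<Sum>l=1..m. card (D l))"
    unfolding U_def using finD disj by (intro card_UN_disjoint) auto
  hence cardU: "card U = m * k" using Dc(2) by simp
  \<comment> \<open>A nonzero sum would force p to divide \<open>k * (m - 2)\<close>, which this
    case excludes.\<close>
  have vanish: "(\<Sum>l=1..m. \<Sum>x\<in>D l. \<psi> x) = 0"
    if "character_on G (carrier G) \<psi>" "\<And>x. x \<in> carrier G \<Longrightarrow> \<psi> x ^ (p ^ a) = 1"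
      "g \<in> carrier G" "\<psi> g \<noteq> 1" for \<psi> g
    using nonzero_character_sum_imp_dvd[OF assms(1,2) D assms(5,6) that(1,3,4,2)] False by blast
  have "p ^ a dvd order G" using assms(3,9) by (simp add: exactly_divides_def)
  then obtain w where w: "order G = p ^ a * w" by (elim dvdE)
  hence w': "\<not> p dvd w" using assms(3,9) by (auto simp: exactly_divides_def mult.commute)
  have "p ^ a dvd card U"
  proof (rule prime_power_dvd_card_of_vanishing_characters[OF assms(2,6) w w'])
    show "U \<subseteq> carrier G" unfolding U_def using Dc(1) by (rule UN_least)
    fix \<psi> g
    assume "character_on G (carrier G) \<psi>" "\<And>x. x \<in> carrier G \<Longrightarrow> \<psi> x ^ (p ^ a) = 1"
      "g \<in> carrier G" "\<psi> g \<noteq> 1"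
    from vanish[OF this] show "(\<Sum>x\<in>U. \<psi> x) = 0"
      unfolding U_def using finD disj by (subst sum.UNION_disjoint) auto
  qed
  moreover have "even u" if u: "self_conjugate q p" "exactly_divides q u lam" for u
  proof -
    have "p dvd order G" using w assms(8) by (simp add: dvd_power)
    then obtain \<psi> g where \<psi>: "character_on G (carrier G) \<psi>" "\<And>x. x \<in> carrier G \<Longrightarrow> \<psi> x ^ p = 1"
      "g \<in> carrier G" "\<psi> g \<noteq> 1"
      using exists_character_of_prime_order[OF assms(2,6)] by blast
    \<comment> \<open>As \<open>a\<close> is positive, a character of order p also satisfies the p^a
      condition of \<open>vanish\<close>. Thus s = 0, and the relation for S_1 says that its norm is
      \<open>lam\<close>.\<close>
    obtain a' where "a = Suc a'" using assms(8) by (cases a) auto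
    hence "\<psi> x ^ (p ^ a) = 1" if "x \<in> carrier G" for x using \<psi>(2)[OF that] by (simp add: power_mult)
    hence s: "(\<Sum>l=1..m. \<Sum>x\<in>D l. \<psi> x) = 0" using vanish[OF \<psi>(1) _ \<psi>(3,4)] by blast
    have 1: "1 \<in> {1..m}" using assms(5) by simp
    have norm: "(\<Sum>x\<in>D 1. \<psi> x) * cnj (\<Sum>x\<in>D 1. \<psi> x) = of_nat lam"
      using sum_character_external_differences[OF assms(1,2) D 1 \<psi>(1,3,4)] unfolding s by simp
    have "\<not> p dvd card (D 1)" using False Dc(2)[OF 1] by (metis dvd_mult2)
    from even_exponent_of_norm[OF assms(6,7,10,11) finD[OF 1] this _ norm u] \<psi>(2) Dc(1)[OF 1]
    show ?thesis by blast
  qed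
  ultimately show ?thesis unfolding cardU by blast
qed

end
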